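(* For every integer $j \ge 4$, letting $n = 2j$ be the number of vertices, $\mathrm{RED{:}IC}(P_2 \square P_j) = \mathrm{RED{:}IC}(P_2 \square C_j) = \left\lceil \tfrac{2}{3} n \right\rceil$.
   Context: $P_j$ is the path on $j$ vertices, $C_j$ the cycle on $j$ vertices, and $\square$ the Cartesian product of graphs (so $P_2 \square P_j$ is the ladder and $P_2 \square C_j$ the cylinder/prism, each with $2j$ vertices). $N[v]$ denotes the closed neighborhood of $v$ and $\Delta$ symmetric difference. A set $S \subseteq V(G)$ is a redundant identifying code if every vertex $v$ satisfies $|N[v] \cap S| \ge 2$ and every pair of distinct vertices $u,v$ satisfies $|(N[u]\cap S)\,\Delta\,(N[v]\cap S)| \ge 2$; $\mathrm{RED{:}IC}(G)$ is the minimum cardinality of such a set. *)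

theory Defs
  imports Complex_Main "HOL-Library.Extended_Nat" "Graph_Theory.Pair_Digraph"
begin

text \<open>
  A finite simple graph is a \<^term>\<open>pair_graph\<close>: finite, loop-free, and with a symmetric
  set of arcs.
\<close>

definition path_graph :: "nat \<Rightarrow> nat pair_pre_digraph" where
  "path_graph j = \<lparr> pverts = {..<j},
     parcs = {(a, b). a < j \<and> b < j \<and> (b = Suc a \<or> a = Suc b)} \<rparr>"

text \<open>Only meaningful for \<open>j \<ge> 3\<close>; for \<open>j = 1\<close> the definition yields a loop.\<close>

definition cycle_graph :: "nat \<Rightarrow> nat pair_pre_digraph" where
  "cycle_graph j = \<lparr> pverts = {..<j},
     parcs = {(a, b). a < j \<and> b < j \<and> (b = Suc a mod j \<or> a = Suc b mod j)} \<rparr>"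

definition cartesian_product ::
    "'a pair_pre_digraph \<Rightarrow> 'b pair_pre_digraph \<Rightarrow> ('a \<times> 'b) pair_pre_digraph"
    (infixr \<open>\<box>\<close> 80) where
  "G \<box> H = \<lparr> pverts = pverts G \<times> pverts H,
     parcs = {((a, x), (b, y)).
       a = b \<and> a \<in> pverts G \<and> (x, y) \<in> parcs H \<or>
       x = y \<and> x \<in> pverts H \<and> (a, b) \<in> parcs G} \<rparr>"

definition closed_nbhd :: "'a pair_pre_digraph \<Rightarrow> 'a \<Rightarrow> 'a set" where
  "closed_nbhd G v = insert v {u. (v, u) \<in> parcs G}"

definition redundant_identifying_code :: "'a pair_pre_digraph \<Rightarrow> 'a set \<Rightarrow> bool" where
  "redundant_identifying_code G S \<longleftrightarrow>
     S \<subseteq> pverts G \<and>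
     (\<forall>v \<in> pverts G. card (closed_nbhd G v \<inter> S) \<ge> 2) \<and>
     (\<forall>u \<in> pverts G. \<forall>v \<in> pverts G. u \<noteq> v \<longrightarrow>
        card (sym_diff (closed_nbhd G u \<inter> S) (closed_nbhd G v \<inter> S)) \<ge> 2)"

text \<open>
  The infimum in \<^typ>\<open>enat\<close> is attained, hence a minimum, whenever a code exists; it is
  \<open>\<infinity>\<close> otherwise, so an equation with a finite value includes existence.
  The graph is assumed finite, since \<^const>\<open>card\<close> is 0 on infinite sets.
\<close>

definition RED_IC :: "'a pair_pre_digraph \<Rightarrow> enat" where
  "RED_IC G = (INF S \<in> {S. redundant_identifying_code G S}. enat (card S))"

lemma pair_graphI:
  assumes "finite (pverts G)" and "parcs G \<subseteq> pverts G \<times> pverts G"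
    and "sym (parcs G)" and "irrefl (parcs G)"
  shows "pair_graph G"
proof
  show "finite (parcs G)"
    using assms(1,2) by (blast intro: finite_subset finite_SigmaI)
  show "symmetric (with_proj G)"
    using assms(3) by (simp add: symmetric_def arcs_ends_def arc_to_ends_def)
  show "fst e \<in> pverts G" "snd e \<in> pverts G" if "e \<in> parcs G" for e
    using that assms(2) by auto
  show "fst e \<noteq> snd e" if "e \<in> parcs G" for e
    using that assms(4) by (metis irrefl_def prod.collapse)
qed (fact assms(1))

lemma pair_graph_path: "pair_graph (path_graph j)"
  by (rule pair_graphI) (auto simp: path_graph_def sym_def irrefl_def)

lemma pair_graph_cycle:
  assumes "j \<ge> 3"
  shows "pair_graph (cycle_graph j)"
  using assms
  by (intro pair_graphI)
     (auto simp: cycle_graph_def sym_def irrefl_def mod_Suc split: if_splits)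

lemma pair_graph_cartesian_product:
  assumes "pair_graph G" and "pair_graph H"
  shows "pair_graph (G \<box> H)"
proof -
  interpret G: pair_graph G by fact
  interpret H: pair_graph H by fact
  have "parcs G \<subseteq> pverts G \<times> pverts G" "parcs H \<subseteq> pverts H \<times> pverts H"
    using G.in_arcsD1 G.in_arcsD2 H.in_arcsD1 H.in_arcsD2 by auto
  moreover have "(a, b) \<notin> parcs G" if "a = b" for a b
    using that G.pair_no_loops[of "(a, b)"] by auto
  moreover have "(a, b) \<notin> parcs H" if "a = b" for a b
    using that H.pair_no_loops[of "(a, b)"] by auto
  moreover have "(b, a) \<in> parcs G" if "(a, b) \<in> parcs G" for a b
    using that G.arcs_symmetric by blast
  moreover have "(b, a) \<in> parcs H" if "(a, b) \<in> parcs H" for a b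
    using that H.arcs_symmetric by blast
  ultimately show ?thesis
    by (intro pair_graphI) (auto simp: cartesian_product_def sym_def irrefl_def)
qed

lemma card_ladder: "card (pverts (path_graph 2 \<box> path_graph j)) = 2 * j"
  by (simp add: cartesian_product_def path_graph_def card_cartesian_product)

lemma card_prism: "card (pverts (path_graph 2 \<box> cycle_graph j)) = 2 * j"
  by (simp add: cartesian_product_def path_graph_def cycle_graph_def card_cartesian_product)

lemma RED_IC_eq_iff:
  "RED_IC G = enat k \<longleftrightarrow>
     (\<exists>S. redundant_identifying_code G S \<and> card S = k) \<and>
     (\<forall>S. redundant_identifying_code G S \<longrightarrow> k \<le> card S)"
  (is "?L \<longleftrightarrow> ?R")
proof
  let ?A = "(\<lambda>S. enat (card S)) ` {S. redundant_identifying_code G S}"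
  assume L: ?L
  have "?A \<noteq> {}"
  proof
    assume "?A = {}"
    then have "RED_IC G = \<infinity>"
      by (simp only: RED_IC_def Inf_enat_def if_True simp_thms)
    with L show False by simp
  qed
  then have "Inf ?A \<in> ?A"
    unfolding Inf_enat_def by (auto intro: LeastI)
  with L have "enat k \<in> ?A"
    by (simp add: RED_IC_def)
  moreover have "enat k \<le> enat (card S)" if "redundant_identifying_code G S" for S
    using that L by (auto simp: RED_IC_def intro: INF_lower simp flip: L)
  ultimately show ?R by auto
next
  assume ?R
  then show ?L
    unfolding RED_IC_def by (auto intro!: antisym INF_lower2 INF_greatest)
qed

end

theory Submission
  imports Defs
begin

text \<open>
  Lower bound: let \<open>c x\<close> be the number of code vertices in the column over \<open>x\<close>. Any three
  consecutive columns contain at least four code vertices. Summing this cyclically over the prism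
  gives \<open>3 |S| \<ge> 4 j\<close>; over the ladder the end columns contribute the missing terms, since an
  end \<open>x\<close> with neighbour \<open>y\<close> satisfies \<open>2 c x + c y \<ge> 4\<close>.

  Upper bound: one full row, together with a copy in the other row of a dominating set of size
  \<open>\<lceil>j / 3\<rceil>\<close> that contains the neighbours of the ends of the path.
\<close>

section \<open>Neighbourhoods\<close>

lemma closed_nbhd_prism:
  assumes "a < 2" and "x \<in> pverts H"
  shows "closed_nbhd (path_graph 2 \<box> H) (a, x) = insert (1 - a, x) (Pair a ` closed_nbhd H x)"
  using assms unfolding closed_nbhd_def cartesian_product_def path_graph_def by auto

lemma pverts_prism: "pverts (path_graph 2 \<box> H) = {0, 1} \<times> pverts H"
  by (auto simp: cartesian_product_def path_graph_def)

lemma closed_nbhd_path: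
  assumes "Suc (Suc x) < j"
  shows "closed_nbhd (path_graph j) (Suc x) = {x, Suc x, Suc (Suc x)}"
  using assms by (auto simp: closed_nbhd_def path_graph_def)

lemma closed_nbhd_path_first:
  assumes "2 \<le> j"
  shows "closed_nbhd (path_graph j) 0 = {0, 1}"
  using assms by (auto simp: closed_nbhd_def path_graph_def)

lemma closed_nbhd_path_last: "closed_nbhd (path_graph (Suc (Suc m))) (Suc m) = {Suc m, m}"
  by (auto simp: closed_nbhd_def path_graph_def)

text \<open>Centring the neighbourhood at a successor avoids subtraction modulo \<open>j\<close> for
  the predecessor.\<close>

lemma closed_nbhd_cycle:
  assumes "x < j"
  shows "closed_nbhd (cycle_graph j) (Suc x mod j) = {x, Suc x mod j, Suc (Suc x mod j) mod j}"
  using assms by (auto simp: closed_nbhd_def cycle_graph_def mod_Suc split: if_splits)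

section \<open>Lower bound\<close>

definition column_size :: "(nat \<times> 'a) set \<Rightarrow> 'a \<Rightarrow> nat" where
  "column_size S x = of_bool ((0, x) \<in> S) + of_bool ((1, x) \<in> S)"

text \<open>A list in place of a set lets \<open>simp\<close> unfold the bound into membership bits.
  Repeated entries only weaken it, so the listed vertices need not be distinct.\<close>

lemma card_Int_le_sum_list:
  assumes "A \<subseteq> set xs"
  shows "card (A \<inter> S) \<le> (\<Sum>v\<leftarrow>xs. of_bool (v \<in> S))"
  using assms
proof (induction xs arbitrary: A)
  case (Cons v xs)
  have "A \<inter> S \<subseteq> (if v \<in> S then {v} else {}) \<union> ((A - {v}) \<inter> S)"
    by auto
  moreover have fin: "finite ((A - {v}) \<inter> S)"
    using Cons.prems by (meson finite_Diff finite_Int finite_set finite_subset)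
  ultimately have "card (A \<inter> S) \<le> card ((if v \<in> S then {v} else {}) \<union> ((A - {v}) \<inter> S))"
    by (intro card_mono) auto
  also have "\<dots> \<le> card (if v \<in> S then {v} else {}) + card ((A - {v}) \<inter> S)"
    by (rule card_Un_le)
  also have "card ((A - {v}) \<inter> S) \<le> (\<Sum>v\<leftarrow>xs. of_bool (v \<in> S))"
    using Cons.prems by (intro Cons.IH) auto
  finally show ?case by auto
qed simp

lemma code_nbhd_le:
  assumes "redundant_identifying_code G S" and "v \<in> pverts G" and "closed_nbhd G v \<subseteq> set xs"
  shows "2 \<le> (\<Sum>w\<leftarrow>xs. of_bool (w \<in> S) :: nat)"
  using assms card_Int_le_sum_list[OF assms(3), of S]
  unfolding redundant_identifying_code_def by force

text \<open>Only vertices in exactly one of the two closed neighbourhoods can separate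
  \<open>u\<close> from \<open>v\<close>; \<open>xs\<close> has to cover just those.\<close>

lemma code_sym_diff_le:
  assumes "redundant_identifying_code G S" and "u \<in> pverts G" and "v \<in> pverts G" and "u \<noteq> v"
    and "closed_nbhd G u \<subseteq> closed_nbhd G v \<union> set xs"
    and "closed_nbhd G v \<subseteq> closed_nbhd G u \<union> set xs"
  shows "2 \<le> (\<Sum>w\<leftarrow>xs. of_bool (w \<in> S) :: nat)"
proof -
  let ?D = "sym_diff (closed_nbhd G u \<inter> S) (closed_nbhd G v \<inter> S)"
  have "2 \<le> card (?D \<inter> S)"
  proof -
    have "?D \<inter> S = ?D" by auto
    then show ?thesis
      using assms(1-4) by (simp add: redundant_identifying_code_def)
  qed
  also have "\<dots> \<le> (\<Sum>w\<leftarrow>xs. of_bool (w \<in> S))"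
    using assms(5,6) by (intro card_Int_le_sum_list) auto
  finally show ?thesis .
qed

text \<open>
  Domination in column \<open>x\<close> and separation of its two vertices leave only the case of one code
  vertex in column \<open>x\<close> and two, in different rows, in its neighbours. If both lie in the same
  column, the other one contains an undominated vertex. If they lie on a diagonal, then some
  \<open>(a, x)\<close> is not separated from \<open>(1 - a, p)\<close> or \<open>(1 - a, s)\<close>. The vertices \<open>p'\<close> and \<open>s'\<close>
  need not be new, which covers the case of \<open>p\<close> or \<open>s\<close> being a leaf.
\<close>

lemma column_triple_ge:
  assumes code: "redundant_identifying_code (path_graph 2 \<box> H) S"
    and V: "p \<in> pverts H" "x \<in> pverts H" "s \<in> pverts H"
    and N: "closed_nbhd H p = {p', p, x}" "closed_nbhd H x = {p, x, s}"
      "closed_nbhd H s = {x, s, s'}"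
  shows "4 \<le> column_size S p + column_size S x + column_size S s"
proof -
  note nbhd = closed_nbhd_prism[where H = H] N V pverts_prism
  let ?sum = "\<lambda>vs. (\<Sum>v\<leftarrow>vs. of_bool (v \<in> S) :: nat)"
  have D: "2 \<le> ?sum [(a, p'), (a, p), (a, x), (1 - a, p)]"
    "2 \<le> ?sum [(a, p), (a, x), (a, s), (1 - a, x)]"
    "2 \<le> ?sum [(a, x), (a, s), (a, s'), (1 - a, s)]" if "a = 0 \<or> a = 1" for a
  proof -
    show "2 \<le> ?sum [(a, p'), (a, p), (a, x), (1 - a, p)]"
      using that by (intro code_nbhd_le[OF code, of "(a, p)"]; elim disjE; simp add: nbhd)
    show "2 \<le> ?sum [(a, p), (a, x), (a, s), (1 - a, x)]"
      using that by (intro code_nbhd_le[OF code, of "(a, x)"]; elim disjE; simp add: nbhd)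
    show "2 \<le> ?sum [(a, x), (a, s), (a, s'), (1 - a, s)]"
      using that by (intro code_nbhd_le[OF code, of "(a, s)"]; elim disjE; simp add: nbhd)
  qed
  have twins: "2 \<le> ?sum [(0, p), (1, p), (0, s), (1, s)]"
    by (rule code_sym_diff_le[OF code, of "(0, x)" "(1, x)"]) (auto simp: nbhd)
  \<comment> \<open>The vertices \<open>(a, x)\<close> and \<open>(1 - a, s)\<close> share the
    neighbours \<open>(a, s)\<close> and \<open>(1 - a, x)\<close>, which therefore cancel; likewise
    with \<open>p\<close> for \<open>s\<close>. In the diagonal case this is applied to the row
    \<open>a\<close> in which column \<open>x\<close> has no code vertex.\<close>
  have diag: "2 \<le> ?sum [(a, x), (a, p), (1 - a, s), (1 - a, s')]"
    "2 \<le> ?sum [(a, x), (a, s), (1 - a, p), (1 - a, p')]" if "a = 0 \<or> a = 1" for a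
  proof -
    show "2 \<le> ?sum [(a, x), (a, p), (1 - a, s), (1 - a, s')]"
      using that by (intro code_sym_diff_le[OF code, of "(a, x)" "(1 - a, s)"]; elim disjE; simp add: nbhd)
    show "2 \<le> ?sum [(a, x), (a, s), (1 - a, p), (1 - a, p')]"
      using that by (intro code_sym_diff_le[OF code, of "(a, x)" "(1 - a, p)"]; elim disjE; simp add: nbhd)
  qed
  show ?thesis
    using D[of 0] D[of 1] twins diag[of 0] diag[of 1] unfolding column_size_def
    by (cases "(0, x) \<in> S"; cases "(1, x) \<in> S"; cases "(0, p) \<in> S"; cases "(1, p) \<in> S";
        cases "(0, s) \<in> S"; cases "(1, s) \<in> S"; auto split: split_of_bool_asm)
qed

text \<open>The closed neighbourhoods of the two vertices over \<open>x\<close> can differ only over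
  \<open>s\<close>, so both vertices over \<open>s\<close> are in the code. Domination then forces a
  code vertex over \<open>x\<close>.\<close>

lemma column_end_ge:
  assumes code: "redundant_identifying_code (path_graph 2 \<box> H) S"
    and V: "x \<in> pverts H" and N: "closed_nbhd H x = {x, s}"
  shows "4 \<le> 2 * column_size S x + column_size S s"
proof -
  note nbhd = closed_nbhd_prism[where H = H] N V pverts_prism
  let ?sum = "\<lambda>vs. (\<Sum>v\<leftarrow>vs. of_bool (v \<in> S) :: nat)"
  have D: "2 \<le> ?sum [(a, x), (a, s), (1 - a, x)]" if "a = 0 \<or> a = 1" for a
    using that by (intro code_nbhd_le[OF code, of "(a, x)"]; elim disjE; simp add: nbhd)
  have twins: "2 \<le> ?sum [(0, s), (1, s)]"
    by (rule code_sym_diff_le[OF code, of "(0, x)" "(1, x)"]) (auto simp: nbhd)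
  show ?thesis
    using D[of 0] D[of 1] twins
    unfolding column_size_def of_bool_def by (simp split: if_splits)
qed

section \<open>Summation over the columns\<close>

lemma card_eq_sum_column_size:
  assumes "redundant_identifying_code (path_graph 2 \<box> H) S" and "finite (pverts H)"
  shows "card S = (\<Sum>x\<in>pverts H. column_size S x)"
proof -
  have S: "S \<subseteq> {0, 1} \<times> pverts H"
    using assms(1) by (simp add: redundant_identifying_code_def pverts_prism)
  have "card S = (\<Sum>v\<in>{0, 1} \<times> pverts H. of_bool (v \<in> S))"
    using S assms(2) by (simp add: of_bool_def sum.If_cases Int_absorb1)
  also have "\<dots> = (\<Sum>a\<in>{0, 1}. \<Sum>x\<in>pverts H. of_bool ((a, x) \<in> S))"
    by (simp add: sum.cartesian_product)
  finally show ?thesis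
    by (simp add: column_size_def sum.distrib)
qed

text \<open>The \<open>m\<close> triples count each column three times, except that an end column
  falls short by two and the neighbour of an end by one. The two end terms make up the
  difference.\<close>

lemma sum_triples:
  fixes c :: "nat \<Rightarrow> nat"
  shows "(\<Sum>x<m. c x + c (Suc x) + c (Suc (Suc x))) + (2 * c 0 + c 1) + (2 * c (Suc m) + c m)
    = 3 * (\<Sum>x<Suc (Suc m). c x)"
  by (induction m) auto

lemma sum_cyclic_shift:
  fixes c :: "nat \<Rightarrow> nat"
  assumes "0 < j"
  shows "(\<Sum>x<j. c (Suc x mod j)) = (\<Sum>x<j. c x)"
proof -
  have "inj_on (\<lambda>x. Suc x mod j) {..<j}"
    by (rule inj_onI) (auto simp: mod_Suc split: if_splits)
  moreover have "(\<lambda>x. Suc x mod j) ` {..<j} \<subseteq> {..<j}"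
    using assms by auto
  ultimately have "bij_betw (\<lambda>x. Suc x mod j) {..<j} {..<j}"
    by (simp add: bij_betw_def endo_inj_surj)
  then show ?thesis
    by (rule sum.reindex_bij_betw)
qed

lemma code_ladder_ge:
  assumes code: "redundant_identifying_code (path_graph 2 \<box> path_graph j) S" and "2 \<le> j"
  shows "4 * j \<le> 3 * card S"
proof -
  obtain m where j: "j = Suc (Suc m)"
    using \<open>2 \<le> j\<close> by (metis add_2_eq_Suc le_Suc_ex)
  let ?c = "column_size S"
  have V: "pverts (path_graph j) = {..<Suc (Suc m)}"
    by (simp add: path_graph_def j)
  have "4 \<le> ?c x + ?c (Suc x) + ?c (Suc (Suc x))" if "x < m" for x
  proof -
    \<comment> \<open>At the left end \<open>x - 1\<close> is \<open>x\<close> itself, and at the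
      right end the conditional below repeats the last vertex, so both ends fit the three-element
      form that \<open>column_triple_ge\<close> expects.\<close>
    have "closed_nbhd (path_graph j) x = {x - 1, x, Suc x}"
      using that by (auto simp: j closed_nbhd_def path_graph_def)
    moreover have "closed_nbhd (path_graph j) (Suc (Suc x))
        = {Suc x, Suc (Suc x), if Suc x = m then Suc (Suc x) else Suc (Suc (Suc x))}"
      using that by (auto simp: j closed_nbhd_def path_graph_def)
    ultimately show ?thesis
      using that by (intro column_triple_ge[OF code]) (auto simp: closed_nbhd_path j V[unfolded j])
  qed
  then have "(\<Sum>x<m. 4) \<le> (\<Sum>x<m. ?c x + ?c (Suc x) + ?c (Suc (Suc x)))"
    by (intro sum_mono) auto
  moreover have "4 \<le> 2 * ?c 0 + ?c 1"
    by (rule column_end_ge[OF code]) (simp_all add: V closed_nbhd_path_first[OF \<open>2 \<le> j\<close>])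
  moreover have "4 \<le> 2 * ?c (Suc m) + ?c m"
    by (rule column_end_ge[OF code]) (simp_all add: V j closed_nbhd_path_last V[unfolded j])
  moreover have "card S = (\<Sum>x<Suc (Suc m). ?c x)"
    using card_eq_sum_column_size[OF code] by (simp only: V finite_lessThan)
  ultimately show ?thesis
    using sum_triples[where c = ?c and m = m] j by simp
qed

lemma code_prism_ge:
  assumes code: "redundant_identifying_code (path_graph 2 \<box> cycle_graph j) S" and "0 < j"
  shows "4 * j \<le> 3 * card S"
proof -
  let ?c = "column_size S" and ?s = "\<lambda>x. Suc x mod j"
  have V: "pverts (cycle_graph j) = {..<j}"
    by (simp add: cycle_graph_def)
  have "4 \<le> ?c x + ?c (?s x) + ?c (?s (?s x))" if "x < j" for x
  proof -
    \<comment> \<open>The triple starts at \<open>x\<close>, whose neighbourhood is known only when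
      \<open>x\<close> is written as a successor.\<close>
    obtain p where p: "p < j" "?s p = x"
    proof (cases x)
      case 0
      then show ?thesis using that[of "j - 1"] \<open>0 < j\<close> by simp
    next
      case (Suc y)
      then show ?thesis using that[of y] \<open>x < j\<close> by simp
    qed
    have "closed_nbhd (cycle_graph j) x = {p, x, ?s x}"
      using closed_nbhd_cycle[OF p(1)] p(2) by simp
    then show ?thesis
      using \<open>x < j\<close>
      by (intro column_triple_ge[OF code]) (simp_all add: V closed_nbhd_cycle)
  qed
  then have "(\<Sum>x<j. 4) \<le> (\<Sum>x<j. ?c x + ?c (?s x) + ?c (?s (?s x)))"
    by (intro sum_mono) auto
  also have "\<dots> = 3 * (\<Sum>x<j. ?c x)"
    using sum_cyclic_shift[OF \<open>0 < j\<close>, of ?c] sum_cyclic_shift[OF \<open>0 < j\<close>, of "\<lambda>x. ?c (?s x)"]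
    by (simp add: sum.distrib)
  also have "(\<Sum>x<j. ?c x) = card S"
    using card_eq_sum_column_size[OF code] by (simp only: V finite_lessThan)
  finally show ?thesis by simp
qed

section \<open>Upper bound\<close>

lemma two_le_card:
  assumes "finite A" and "u \<in> A" and "v \<in> A" and "u \<noteq> v"
  shows "2 \<le> card A"
  using card_mono[of A "{u, v}"] assms by simp

text \<open>A row-0 vertex sees its whole neighbourhood in \<open>H\<close>, while a row-1 vertex
  sees only its own copy in row 0, together with nearby members of \<open>T\<close> in row 1. In
  each case two explicit separating vertices are named. The second alternative in
  \<open>nbrs\<close> is meant for leaves.\<close>

lemma code_from_dominating_set:
  fixes H :: "'a pair_pre_digraph"
  assumes "pair_graph H" and T: "T \<subseteq> pverts H"
    and dominating: "\<And>x. x \<in> pverts H \<Longrightarrow> closed_nbhd H x \<inter> T \<noteq> {}"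
    and triangle_free: "\<And>x y z. (x, y) \<in> parcs H \<Longrightarrow> (y, z) \<in> parcs H \<Longrightarrow> (z, x) \<notin> parcs H"
    and nbrs: "\<And>x. x \<in> pverts H \<Longrightarrow>
      (\<exists>y z. y \<noteq> z \<and> (x, y) \<in> parcs H \<and> (x, z) \<in> parcs H) \<or>
      (\<exists>y z. y \<in> T \<and> z \<noteq> x \<and> (x, y) \<in> parcs H \<and> (y, z) \<in> parcs H)"
  shows "redundant_identifying_code (path_graph 2 \<box> H) ({0} \<times> pverts H \<union> {1} \<times> T)"
    (is "redundant_identifying_code ?G ?S")
proof -
  interpret pair_graph H by fact
  let ?V = "pverts H" and ?E = "parcs H"
  let ?N = "closed_nbhd ?G"
  have sym: "(y, x) \<in> ?E" if "(x, y) \<in> ?E" for x y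
    using that arcs_symmetric by blast
  have irr: "(x, x) \<notin> ?E" for x
    using pair_no_loops[of "(x, x)"] by auto
  have E: "x \<in> ?V" "y \<in> ?V" if "(x, y) \<in> ?E" for x y
    using that in_arcsD1 in_arcsD2 by auto
  have fin: "finite ?S"
    using finite_subset[OF T pair_finite_verts] by simp
  have N0: "?N (0, x) \<inter> ?S = {0} \<times> closed_nbhd H x \<union> {1} \<times> ({x} \<inter> T)" if "x \<in> ?V" for x
    using that E T by (auto simp: closed_nbhd_prism closed_nbhd_def[of H])
  have N1: "?N (1, x) \<inter> ?S = {(0, x)} \<union> {1} \<times> (closed_nbhd H x \<inter> T)" if "x \<in> ?V" for x
    using that E T by (auto simp: closed_nbhd_prism closed_nbhd_def[of H])
  define M where "M u = ?N u \<inter> ?S" for u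
  have M0: "M (0, x) = {0} \<times> closed_nbhd H x \<union> {1} \<times> ({x} \<inter> T)" if "x \<in> ?V" for x
    using that N0 by (simp add: M_def)
  \<comment> \<open>The second form is needed because \<open>simp\<close> rewrites \<open>1\<close>
    to \<open>Suc 0\<close>.\<close>
  have M1: "M (1, x) = {(0, x)} \<union> {1} \<times> (closed_nbhd H x \<inter> T)"
    "M (Suc 0, x) = {(0, x)} \<union> {1} \<times> (closed_nbhd H x \<inter> T)" if "x \<in> ?V" for x
    using that N1 by (simp_all add: M_def)
  note M = M0 M1 closed_nbhd_def[of H]
  let ?D = "\<lambda>u v. sym_diff (M u) (M v)"
  have fin': "finite (M u)" "finite (?D u v)" for u v
    using fin by (simp_all add: M_def)
  have nbr: "\<exists>y. (x, y) \<in> ?E" if "x \<in> ?V" for x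
    using nbrs[OF that] by blast
  have dom: "2 \<le> card (M (a, x))" if "a \<in> {0, 1}" "x \<in> ?V" for a x
  proof (cases "a = 0")
    case True
    obtain y where "(x, y) \<in> ?E" using nbr \<open>x \<in> ?V\<close> by blast
    then show ?thesis
      using True \<open>x \<in> ?V\<close> irr by (intro two_le_card[OF fin'(1), of "(0, x)" _ "(0, y)"]) (auto simp: M)
  next
    case False
    obtain y where "y \<in> closed_nbhd H x \<inter> T" using dominating \<open>x \<in> ?V\<close> by blast
    then show ?thesis
      using that False by (intro two_le_card[OF fin'(1), of "(0, x)" _ "(1, y)"]) (auto simp: M)
  qed
  \<comment> \<open>In row 0, \<open>(1, y)\<close> sees only \<open>(0, y)\<close>, so any two
    vertices of \<open>closed_nbhd H x\<close> other than \<open>y\<close> separate. If only one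
    such vertex is guaranteed, \<open>(1, s)\<close> is the second.\<close>
  have D_mixed: "2 \<le> card (?D (0, x) (1, y))" if "x \<in> ?V" "y \<in> ?V" for x y
    using nbrs[OF \<open>x \<in> ?V\<close>]
  proof (elim disjE exE conjE)
    fix s t assume st: "s \<noteq> t" "(x, s) \<in> ?E" "(x, t) \<in> ?E"
    have "x \<noteq> s" "x \<noteq> t" using st irr by auto
    consider "y = s" | "y = t" | "y \<noteq> s" "y \<noteq> t" by blast
    then show ?thesis
    proof cases
      case 1
      then show ?thesis
        using st that \<open>x \<noteq> s\<close> \<open>x \<noteq> t\<close>
        by (intro two_le_card[OF fin'(2), of "(0, x)" _ _ "(0, t)"]) (auto simp: M)
    next
      case 2
      then show ?thesis
        using st that \<open>x \<noteq> s\<close> \<open>x \<noteq> t\<close>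
        by (intro two_le_card[OF fin'(2), of "(0, x)" _ _ "(0, s)"]) (auto simp: M)
    next
      case 3
      then show ?thesis
        using st that by (intro two_le_card[OF fin'(2), of "(0, s)" _ _ "(0, t)"]) (auto simp: M)
    qed
  next
    fix s t assume st: "s \<in> T" "(x, s) \<in> ?E"
    have "x \<noteq> s" using st irr by auto
    consider "y = x" | "y = s" | "y \<noteq> x" "y \<noteq> s" by blast
    then show ?thesis
    proof cases
      case 1
      then show ?thesis
        using st that \<open>x \<noteq> s\<close>
        by (intro two_le_card[OF fin'(2), of "(0, s)" _ _ "(1, s)"]) (auto simp: M)
    next
      case 2
      then show ?thesis
        using st that \<open>x \<noteq> s\<close>
        by (intro two_le_card[OF fin'(2), of "(0, x)" _ _ "(1, s)"]) (auto simp: M)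
    next
      case 3
      then show ?thesis
        using st that \<open>x \<noteq> s\<close>
        by (intro two_le_card[OF fin'(2), of "(0, x)" _ _ "(0, s)"]) (auto simp: M)
    qed
  qed
  have D_leaf: "2 \<le> card (?D (0, x) (0, y))"
    if "(x, y) \<in> ?E" "y \<in> T" "z \<noteq> x" "(y, z) \<in> ?E" for x y z
  proof -
    have "x \<noteq> y" "(x, z) \<notin> ?E" using that irr triangle_free[of x y z] sym by auto
    then show ?thesis
      using that E[OF that(1)]
      by (intro two_le_card[OF fin'(2), of "(0, z)" _ _ "(1, y)"]) (auto simp: M)
  qed
  have D0: "2 \<le> card (?D (0, x) (0, y))" if xy: "x \<in> ?V" "y \<in> ?V" "x \<noteq> y" for x y
  proof (cases "(x, y) \<in> ?E")
    case False
    then have "(y, x) \<notin> ?E" using sym by blast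
    then show ?thesis
      using that False by (intro two_le_card[OF fin'(2), of "(0, x)" _ _ "(0, y)"]) (auto simp: M)
  next
    case True
    \<comment> \<open>If the \<open>T\<close>-neighbour given by \<open>nbrs\<close> is not the
      other endpoint of the edge, it is itself a further neighbour. So each endpoint has a further
      neighbour unless the other endpoint is in \<open>T\<close> and has one.\<close>
    consider (two) s t where "s \<noteq> y" "(x, s) \<in> ?E" "t \<noteq> x" "(y, t) \<in> ?E"
      | (left) z where "y \<in> T" "z \<noteq> x" "(y, z) \<in> ?E"
      | (right) z where "x \<in> T" "z \<noteq> y" "(x, z) \<in> ?E"
      using nbrs[OF xy(1)] nbrs[OF xy(2)] by metis
    then show ?thesis
    proof cases
      case two
      have "(y, s) \<notin> ?E" "(x, t) \<notin> ?E" "s \<noteq> x" "t \<noteq> y"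
        using two True triangle_free sym irr by blast+
      then show ?thesis
        using two that by (intro two_le_card[OF fin'(2), of "(0, s)" _ _ "(0, t)"]) (auto simp: M)
    next
      case left
      then show ?thesis using D_leaf True by blast
    next
      case right
      then have "2 \<le> card (?D (0, y) (0, x))" using D_leaf sym[OF True] by blast
      then show ?thesis by (simp add: Un_commute)
    qed
  qed
  have D1: "2 \<le> card (?D (1, x) (1, y))" if "x \<in> ?V" "y \<in> ?V" "x \<noteq> y" for x y
    using that by (intro two_le_card[OF fin'(2), of "(0, x)" _ _ "(0, y)"]) (auto simp: M)
  have "2 \<le> card (?D (a, x) (b, y))"
    if "a \<in> {0, 1}" "b \<in> {0, 1}" "x \<in> ?V" "y \<in> ?V" "(a, x) \<noteq> (b, y)" for a b x y
  proof -
    have "?D (1, x) (0, y) = ?D (0, y) (1, x)" by (rule Un_commute)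
    then show ?thesis
      using that D0[of x y] D1[of x y] D_mixed[of x y] D_mixed[of y x] by auto
  qed
  then show ?thesis
    using dom T unfolding redundant_identifying_code_def pverts_prism M_def by blast
qed

section \<open>A dominating set of the path\<close>

text \<open>The centres of consecutive blocks of three, with the last one clipped to
  \<open>j - 2\<close>. Clipping keeps an incomplete last block dominated and puts the neighbour of
  the right end into the set.\<close>

definition path_dominating_set :: "nat \<Rightarrow> nat set" where
  "path_dominating_set j = (\<lambda>i. min (3 * i + 1) (j - 2)) ` {..<(j + 2) div 3}"

lemma card_path_dominating_set: "card (path_dominating_set j) \<le> (j + 2) div 3"
  unfolding path_dominating_set_def using card_image_le[OF finite_lessThan] by (metis card_lessThan)

lemma path_dominating_set_subset: "2 \<le> j \<Longrightarrow> path_dominating_set j \<subseteq> {..<j}"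
  by (auto simp: path_dominating_set_def)

lemma one_in_path_dominating_set: "3 \<le> j \<Longrightarrow> 1 \<in> path_dominating_set j"
  unfolding path_dominating_set_def by (rule image_eqI[of _ _ 0]) auto

lemma last_in_path_dominating_set: "3 \<le> j \<Longrightarrow> j - 2 \<in> path_dominating_set j"
  unfolding path_dominating_set_def by (rule image_eqI[of _ _ "(j + 2) div 3 - 1"]) auto

lemma path_dominating_set_dominates:
  assumes "2 \<le> j" and "x < j"
  obtains y where "y \<in> path_dominating_set j" "y < j" "x = y \<or> x = Suc y \<or> y = Suc x"
proof
  \<comment> \<open>The possibly clipped centre of the block containing \<open>x\<close>.\<close>
  let ?y = "min (3 * (x div 3) + 1) (j - 2)"
  have "x div 3 < (j + 2) div 3"
    using assms by presburger
  then show "?y \<in> path_dominating_set j"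
    by (auto simp: path_dominating_set_def)
  show "?y < j" using assms by auto
  show "x = ?y \<or> x = Suc ?y \<or> ?y = Suc x"
    using assms by presburger
qed

lemma code_ladder:
  assumes "4 \<le> j"
  shows "redundant_identifying_code (path_graph 2 \<box> path_graph j)
    ({0} \<times> {..<j} \<union> {1} \<times> path_dominating_set j)"
proof -
  let ?T = "path_dominating_set j"
  have V: "pverts (path_graph j) = {..<j}" by (simp add: path_graph_def)
  have "redundant_identifying_code (path_graph 2 \<box> path_graph j)
    ({0} \<times> pverts (path_graph j) \<union> {1} \<times> ?T)"
  proof (rule code_from_dominating_set)
    show "pair_graph (path_graph j)" by (rule pair_graph_path)
    show "?T \<subseteq> pverts (path_graph j)" using path_dominating_set_subset assms by (simp add: V)
    show "closed_nbhd (path_graph j) x \<inter> ?T \<noteq> {}" if "x \<in> pverts (path_graph j)" for x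
    proof -
      from that have "x < j" by (simp add: V)
      then obtain y where "y \<in> ?T" "y < j" "x = y \<or> x = Suc y \<or> y = Suc x"
        using path_dominating_set_dominates[of j x] assms by auto
      then show ?thesis using \<open>x < j\<close> by (auto simp: closed_nbhd_def path_graph_def)
    qed
    show "(z, x) \<notin> parcs (path_graph j)"
      if "(x, y) \<in> parcs (path_graph j)" "(y, z) \<in> parcs (path_graph j)" for x y z
      using that by (auto simp: path_graph_def)
    show "(\<exists>y z. y \<noteq> z \<and> (x, y) \<in> parcs (path_graph j) \<and> (x, z) \<in> parcs (path_graph j)) \<or>
      (\<exists>y z. y \<in> ?T \<and> z \<noteq> x \<and> (x, y) \<in> parcs (path_graph j) \<and> (y, z) \<in> parcs (path_graph j))"
      (is "?two x \<or> ?leaf x") if "x \<in> pverts (path_graph j)" for x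
    proof -
      from that have "x < j" by (simp add: V)
      consider "x = 0" | "x = j - 1" | "0 < x" "Suc x < j" using \<open>x < j\<close> by linarith
      then show ?thesis
      proof cases
        case 1
        then have "?leaf x"
          using assms one_in_path_dominating_set[of j]
          by (intro exI[of _ 1] exI[of _ 2]) (auto simp: path_graph_def)
        then show ?thesis ..
      next
        case 2
        then have "?leaf x"
          using assms last_in_path_dominating_set[of j]
          by (intro exI[of _ "j - 2"] exI[of _ "j - 3"]) (auto simp: path_graph_def)
        then show ?thesis ..
      next
        case 3
        then have "?two x"
          by (intro exI[of _ "x - 1"] exI[of _ "Suc x"]) (auto simp: path_graph_def)
        then show ?thesis ..
      qed
    qed
  qed
  then show ?thesis by (simp add: V)
qed

text \<open>The path spans the cycle, so its dominating set still dominates. There are no leaves: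
  the first alternative of \<open>nbrs\<close> always holds.\<close>

lemma code_prism:
  assumes "4 \<le> j"
  shows "redundant_identifying_code (path_graph 2 \<box> cycle_graph j)
    ({0} \<times> {..<j} \<union> {1} \<times> path_dominating_set j)"
proof -
  let ?T = "path_dominating_set j"
  have V: "pverts (cycle_graph j) = {..<j}" by (simp add: cycle_graph_def)
  have "redundant_identifying_code (path_graph 2 \<box> cycle_graph j)
    ({0} \<times> pverts (cycle_graph j) \<union> {1} \<times> ?T)"
  proof (rule code_from_dominating_set)
    show "pair_graph (cycle_graph j)" using assms by (intro pair_graph_cycle) simp
    show "?T \<subseteq> pverts (cycle_graph j)" using path_dominating_set_subset assms by (simp add: V)
    show "closed_nbhd (cycle_graph j) x \<inter> ?T \<noteq> {}" if "x \<in> pverts (cycle_graph j)" for x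
    proof -
      from that have "x < j" by (simp add: V)
      then obtain y where "y \<in> ?T" "y < j" "x = y \<or> x = Suc y \<or> y = Suc x"
        using path_dominating_set_dominates[of j x] assms by auto
      then show ?thesis using \<open>x < j\<close> by (auto simp: closed_nbhd_def cycle_graph_def)
    qed
    \<comment> \<open>The bound \<open>4 \<le> j\<close> matters here, since the cycle on three
      vertices is a triangle.\<close>
    show "(z, x) \<notin> parcs (cycle_graph j)"
      if "(x, y) \<in> parcs (cycle_graph j)" "(y, z) \<in> parcs (cycle_graph j)" for x y z
      using that assms by (auto simp: cycle_graph_def mod_Suc split: if_splits)
    show "(\<exists>y z. y \<noteq> z \<and> (x, y) \<in> parcs (cycle_graph j) \<and> (x, z) \<in> parcs (cycle_graph j)) \<or>
      (\<exists>y z. y \<in> ?T \<and> z \<noteq> x \<and> (x, y) \<in> parcs (cycle_graph j) \<and> (y, z) \<in> parcs (cycle_graph j))"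
      if "x \<in> pverts (cycle_graph j)" for x
      using that assms
      by (intro disjI1 exI[of _ "if x = 0 then j - 1 else x - 1"] exI[of _ "Suc x mod j"])
         (auto simp: cycle_graph_def mod_Suc split: if_splits)
  qed
  then show ?thesis by (simp add: V)
qed

section \<open>Matching the two bounds\<close>

lemma card_row_Un_dominating_set:
  assumes "2 \<le> j"
  shows "card ({0::nat} \<times> {..<j} \<union> {1} \<times> path_dominating_set j) \<le> (4 * j + 2) div 3"
proof -
  have "card ({0::nat} \<times> {..<j} \<union> {1} \<times> path_dominating_set j)
      \<le> card ({0::nat} \<times> {..<j}) + card ({1::nat} \<times> path_dominating_set j)"
    by (rule card_Un_le)
  also have "\<dots> \<le> j + (j + 2) div 3"
    using card_path_dominating_set[of j] by (simp add: card_cartesian_product)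
  finally show ?thesis by linarith
qed

text \<open>The number \<open>(4 * j + 2) div 3\<close> is the ceiling of 4j/3, hence the least
  \<open>k\<close> with \<open>4 * j \<le> 3 * k\<close>; the lower bound therefore meets the size
  of \<open>S\<close> exactly.\<close>

lemma RED_IC_eqI:
  assumes "redundant_identifying_code G S" and "card S \<le> (4 * j + 2) div 3"
    and lower: "\<And>S'. redundant_identifying_code G S' \<Longrightarrow> 4 * j \<le> 3 * card S'"
  shows "RED_IC G = enat ((4 * j + 2) div 3)"
proof -
  have "(4 * j + 2) div 3 \<le> card S'" if "redundant_identifying_code G S'" for S'
    using lower[OF that] by linarith
  then show ?thesis
    using assms(1,2) unfolding RED_IC_eq_iff by (metis le_antisym)
qed

theorem theorem9:
  fixes j n :: nat
  assumes "j \<ge> 4" and "n = 2 * j"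
  shows "RED_IC (path_graph 2 \<box> path_graph j) = enat (nat \<lceil>2 / 3 * real n\<rceil>) \<and>
         RED_IC (path_graph 2 \<box> cycle_graph j) = enat (nat \<lceil>2 / 3 * real n\<rceil>)"
proof -
  have "\<lceil>2 / 3 * real n\<rceil> = int ((4 * j + 2) div 3)"
  proof (rule ceiling_unique)
    have "3 * ((4 * j + 2) div 3) < 4 * j + 3" "4 * j \<le> 3 * ((4 * j + 2) div 3)"
      by presburger+
    then have "3 * real ((4 * j + 2) div 3) < 4 * real j + 3"
      "4 * real j \<le> 3 * real ((4 * j + 2) div 3)"
      by linarith+
    then show "of_int (int ((4 * j + 2) div 3)) - 1 < 2 / 3 * real n"
      "2 / 3 * real n \<le> of_int (int ((4 * j + 2) div 3))"
      using assms(2) by simp_all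
  qed
  then have "nat \<lceil>2 / 3 * real n\<rceil> = (4 * j + 2) div 3"
    by simp
  moreover have "RED_IC (path_graph 2 \<box> path_graph j) = enat ((4 * j + 2) div 3)"
    using assms(1) code_ladder_ge
    by (intro RED_IC_eqI[OF code_ladder card_row_Un_dominating_set]) auto
  moreover have "RED_IC (path_graph 2 \<box> cycle_graph j) = enat ((4 * j + 2) div 3)"
    using assms(1) code_prism_ge
    by (intro RED_IC_eqI[OF code_prism card_row_Un_dominating_set]) auto
  ultimately show ?thesis
    by simp
qed

end
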